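(* Let $P(x,w)\subseteq[0,1]^{d_x}\times\mathbb{R}^{d_w}$ be a mixed integer polytope and let $\rho\ge 1$. For every $\rho$-approximate extended formulation $Q(x,w,y)$ of $P(x,w)$ with a mixed linear section, there is a translation $T[Q(x,w,y)]$ of $Q$ to mixed product relaxations (that is, a substitution $T$ such that $T[Q(x,w,y)]$ is a mixed product relaxation of $P(x,w)$) such that $$P(x,w)\subseteq \operatorname{proj}_{x,w}(T[Q(x,w,y)])\subseteq \operatorname{proj}_{x,w}(Q(x,w,y)).$$
   Context: A mixed integer polytope $P(x,w)\subseteq[0,1]^{d_x}\times\mathbb{R}^{d_w}$ is a polytope of the form $\operatorname{conv}(M)$ with $M\subseteq\{0,1\}^{d_x}\times\mathbb{R}^{d_w}$; the $x$ variables are integer ($0$-$1$), the $w$ variables fractional. Its mixed integer points are those in $P(x,w)\cap(\{0,1\}^{d_x}\times\mathbb{R}^{d_w})$. An extended relaxation of a polyhedron $P$ is a linear system whose projection to the original variables contains $P$. $\rho$-approximate extended formulation: Let $O$ be the given set of admissible objective vectors on the original variables $v=(x,w)$. An extended relaxation $Q(v,y)$ of $P$ is a $\rho$-approximate extended formulation if, for a maximization problem, $\max\{u^Tv\mid (v,y)\in Q\}\ge\max\{u^Tv\mid v\in P\}$ for all real vectors $u$ and $\max\{u^Tv\mid (v,y)\in Q\}\le\rho\max\{u^Tv\mid v\in P\}$ for all $u\in O$; for a minimization problem, $\min\{u^Tv\mid (v,y)\in Q\}\le\min\{u^Tv\mid v\in P\}$ for all real $u$ and $\min\{u^Tv\mid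 (v,y)\in Q\}\ge\rho^{-1}\min\{u^Tv\mid v\in P\}$ for all $u\in O$. Mixed linear section: A section of $Q(x,w,y)$, $y\in\mathbb{R}^{d_y}$, is a function $g$ assigning to each mixed integer point $(x,w)$ of $P$ a point of $Q$ whose projection to the $(x,w)$ variables is $(x,w)$. It is mixed linear if for every $x'\in\{0,1\}^{d_x}$ and every $i=1,\dots,d_y$ its $y_i$-coordinate at $(x',w)$ is an affine function $g_i^{x'}(w)$ of $w$. $Q$ is an extended formulation with a mixed linear section if such a section exists. Mixed product relaxation: A mixed product relaxation $D(z)$ of $P(x,w)$ is an extended relaxation of $P(x,w)$ in variables $z\in\mathbb{R}^{(d_w+1)2^{d_x}-1}$, consisting of the variables $z_{\{w_j\}}=w_j$, $j=1,\dots,d_w$, and, for every nonempty $\mathcal E\subseteq\{x_1,\dots,x_{d_x}\}$, a variable $z_{\mathcal E}$ and variables $z_{\mathcal E w_j}$, $j=1,\dots,d_w$ (with $z_{\{x_i\}}$ identified with $x_i$), such that for every mixed integer point $(x,w)$ of $P$ the vector $f(x,w)$ with coordinates $f_{\mathcal E}(x,w)=\prod_{x_i\in\mathcal E}x_i$ and $f_{\mathcal E w_j}(x,w)=(\prod_{x_i\in\mathcal E}x_i)\,w_j$ (and coordinate $w_j$ at $z_{\{w_j\}}$) belongs to $D(z)$. Substitution and translation: A substitution $T$ expresses each $y_i$ as an affine function of the mixed product variables $z$; $T[Q(x,w,y)]$ is the linear system in $z$ obtained from the system defining $Q$ by substituting these expressions for the $y_i$ and the variables $z_{\{x_i\}},z_{\{w_j\}}$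 for $x_i,w_j$. If it is a mixed product relaxation of $P(x,w)$ it is called a translation of $Q$ to mixed product relaxations. $\operatorname{proj}_{x,w}$ denotes projection to the coordinates $x,w$. *)

theory Defs
  imports "HOL-Analysis.Analysis" "HOL-Analysis.Finite_Function_Topology"
begin

text \<open>
  For a finite set \<open>I\<close> of variables, the space \<open>\<real>\<^sup>I\<close> is the set of finitely supported functions
  \<open>'i \<Rightarrow>\<^sub>0 real\<close> whose support lies in \<open>I\<close>. This allows all dimensions, including
  \<open>0\<close>, and the library's \<open>convex hull\<close> and \<open>polytope\<close> apply because \<open>'i \<Rightarrow>\<^sub>0 real\<close> is a
  real vector space.
\<close>

definition coord_space :: "'i set \<Rightarrow> ('i \<Rightarrow>\<^sub>0 real) set" where
  "coord_space I = {v. Poly_Mapping.keys v \<subseteq> I}"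

definition vec_of :: "'i set \<Rightarrow> ('i \<Rightarrow> real) \<Rightarrow> ('i \<Rightarrow>\<^sub>0 real)" where
  "vec_of I c = (\<Sum>i\<in>I. Poly_Mapping.single i (c i))"

definition dot :: "('i \<Rightarrow>\<^sub>0 real) \<Rightarrow> ('i \<Rightarrow>\<^sub>0 real) \<Rightarrow> real" where
  "dot a v = (\<Sum>i\<in>Poly_Mapping.keys a. Poly_Mapping.lookup a i * Poly_Mapping.lookup v i)"

text \<open>
  A linear system is a finite set of inequalities \<open>a\<^sup>T v \<le> b\<close>, each given as a pair \<open>(a, b)\<close>;
  an equation is a pair of opposite inequalities.
\<close>

type_synonym 'i lin_system = "(('i \<Rightarrow>\<^sub>0 real) \<times> real) set"

definition linear_system :: "'i set \<Rightarrow> 'i lin_system \<Rightarrow> bool" where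
  "linear_system I S \<longleftrightarrow> finite S \<and> (\<forall>(a, b)\<in>S. a \<in> coord_space I)"

definition solutions :: "'i set \<Rightarrow> 'i lin_system \<Rightarrow> ('i \<Rightarrow>\<^sub>0 real) set" where
  "solutions I S = {v \<in> coord_space I. \<forall>(a, b)\<in>S. dot a v \<le> b}"

text \<open>
  Variables are indexed from \<open>0\<close>. \<open>ZE E\<close> is the variable \<open>z\<^bsub>E\<^esub>\<close> and \<open>ZEW E j\<close> the variable
  \<open>z\<^bsub>E w\<^sub>j\<^esub>\<close>, where \<open>E\<close> is a set of indices of \<open>x\<close>-variables; \<open>ZEW {} j\<close> is
  \<open>z\<^bsub>{w\<^sub>j}\<^esub> = w\<^sub>j\<close>. There is no variable for the empty product \<open>1\<close>.
\<close>

datatype var = VX nat | VW nat | VY nat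

datatype zvar = ZE "nat set" | ZEW "nat set" nat

definition xw_vars :: "nat \<Rightarrow> nat \<Rightarrow> var set" where
  "xw_vars dx dw = VX ` {..<dx} \<union> VW ` {..<dw}"

definition xwy_vars :: "nat \<Rightarrow> nat \<Rightarrow> nat \<Rightarrow> var set" where
  "xwy_vars dx dw dy = xw_vars dx dw \<union> VY ` {..<dy}"

definition z_vars :: "nat \<Rightarrow> nat \<Rightarrow> zvar set" where
  "z_vars dx dw = {ZE E | E. E \<noteq> {} \<and> E \<subseteq> {..<dx}} \<union> {ZEW E j | E j. E \<subseteq> {..<dx} \<and> j < dw}"

lemma card_z_vars: "card (z_vars dx dw) = (dw + 1) * 2 ^ dx - 1"
proof -
  have eq: "z_vars dx dw = ZE ` (Pow {..<dx} - {{}}) \<union> (\<lambda>(E, j). ZEW E j) ` (Pow {..<dx} \<times> {..<dw})"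
    by (auto simp: z_vars_def)
  have 1: "card (ZE ` (Pow {..<dx} - {{}})) = 2 ^ dx - 1"
    by (subst card_image) (auto simp: inj_on_def card_Diff_singleton card_Pow)
  have 2: "card ((\<lambda>(E, j). ZEW E j) ` (Pow {..<dx} \<times> {..<dw})) = 2 ^ dx * dw"
    by (subst card_image) (auto simp: inj_on_def card_cartesian_product card_Pow)
  have "card (z_vars dx dw) = (2 ^ dx - 1) + 2 ^ dx * dw"
    unfolding eq by (subst card_Un_disjoint) (auto simp: 1 2)
  moreover have "(1::nat) \<le> 2 ^ dx"
    by simp
  ultimately show ?thesis
    by (simp add: algebra_simps)
qed

definition mixed_cube :: "nat \<Rightarrow> nat \<Rightarrow> (var \<Rightarrow>\<^sub>0 real) set" where
  "mixed_cube dx dw =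
    {v \<in> coord_space (xw_vars dx dw). \<forall>i<dx. Poly_Mapping.lookup v (VX i) \<in> {0, 1}}"

definition mixed_integer_polytope :: "nat \<Rightarrow> nat \<Rightarrow> (var \<Rightarrow>\<^sub>0 real) set \<Rightarrow> bool" where
  "mixed_integer_polytope dx dw P \<longleftrightarrow>
    P \<subseteq> {v \<in> coord_space (xw_vars dx dw). \<forall>i<dx. Poly_Mapping.lookup v (VX i) \<in> {0..1}} \<and>
    polytope P \<and> (\<exists>M. M \<subseteq> mixed_cube dx dw \<and> P = convex hull M)"

definition mixed_integer_points :: "nat \<Rightarrow> nat \<Rightarrow> (var \<Rightarrow>\<^sub>0 real) set \<Rightarrow> (var \<Rightarrow>\<^sub>0 real) set" where
  "mixed_integer_points dx dw P = P \<inter> mixed_cube dx dw"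

definition proj_xw :: "nat \<Rightarrow> nat \<Rightarrow> (var \<Rightarrow>\<^sub>0 real) \<Rightarrow> (var \<Rightarrow>\<^sub>0 real)" where
  "proj_xw dx dw q = vec_of (xw_vars dx dw) (Poly_Mapping.lookup q)"

definition extended_relaxation ::
    "nat \<Rightarrow> nat \<Rightarrow> nat \<Rightarrow> var lin_system \<Rightarrow> (var \<Rightarrow>\<^sub>0 real) set \<Rightarrow> bool" where
  "extended_relaxation dx dw dy Q P \<longleftrightarrow>
    linear_system (xwy_vars dx dw dy) Q \<and>
    P \<subseteq> proj_xw dx dw ` solutions (xwy_vars dx dw dy) Q"

text \<open>
  Optimal values are suprema and infima in the extended reals, so that infeasible and unbounded
  problems have the usual values \<open>\<plusminus>\<infinity>\<close>. An objective \<open>u\<close> is supported on the \<open>x, w\<close> variables,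
  hence \<open>dot u\<close> evaluates \<open>u\<^sup>T v\<close> on points \<open>(v, y)\<close> as well.
\<close>

datatype sense = Maximize | Minimize

definition opt_max :: "(var \<Rightarrow>\<^sub>0 real) \<Rightarrow> (var \<Rightarrow>\<^sub>0 real) set \<Rightarrow> ereal" where
  "opt_max u S = (SUP v\<in>S. ereal (dot u v))"

definition opt_min :: "(var \<Rightarrow>\<^sub>0 real) \<Rightarrow> (var \<Rightarrow>\<^sub>0 real) set \<Rightarrow> ereal" where
  "opt_min u S = (INF v\<in>S. ereal (dot u v))"

definition approx_extended_formulation ::
    "sense \<Rightarrow> (var \<Rightarrow>\<^sub>0 real) set \<Rightarrow> real \<Rightarrow> nat \<Rightarrow> nat \<Rightarrow> nat \<Rightarrow>
     var lin_system \<Rightarrow> (var \<Rightarrow>\<^sub>0 real) set \<Rightarrow> bool" where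
  "approx_extended_formulation s Obj \<rho> dx dw dy Q P \<longleftrightarrow>
    extended_relaxation dx dw dy Q P \<and>
    (let R = solutions (xwy_vars dx dw dy) Q in
     case s of
       Maximize \<Rightarrow>
         (\<forall>u\<in>coord_space (xw_vars dx dw). opt_max u R \<ge> opt_max u P) \<and>
         (\<forall>u\<in>Obj. opt_max u R \<le> ereal \<rho> * opt_max u P)
     | Minimize \<Rightarrow>
         (\<forall>u\<in>coord_space (xw_vars dx dw). opt_min u R \<le> opt_min u P) \<and>
         (\<forall>u\<in>Obj. opt_min u R \<ge> ereal (inverse \<rho>) * opt_min u P))"

definition is_section ::
    "nat \<Rightarrow> nat \<Rightarrow> nat \<Rightarrow> var lin_system \<Rightarrow> (var \<Rightarrow>\<^sub>0 real) set \<Rightarrow>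
     ((var \<Rightarrow>\<^sub>0 real) \<Rightarrow> (var \<Rightarrow>\<^sub>0 real)) \<Rightarrow> bool" where
  "is_section dx dw dy Q P g \<longleftrightarrow>
    (\<forall>p\<in>mixed_integer_points dx dw P.
      g p \<in> solutions (xwy_vars dx dw dy) Q \<and> proj_xw dx dw (g p) = p)"

definition mixed_linear ::
    "nat \<Rightarrow> nat \<Rightarrow> nat \<Rightarrow> (var \<Rightarrow>\<^sub>0 real) set \<Rightarrow> ((var \<Rightarrow>\<^sub>0 real) \<Rightarrow> (var \<Rightarrow>\<^sub>0 real)) \<Rightarrow> bool" where
  "mixed_linear dx dw dy P g \<longleftrightarrow>
    (\<forall>x' :: nat \<Rightarrow> real. (\<forall>i<dx. x' i \<in> {0, 1}) \<longrightarrow>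
      (\<forall>k<dy. \<exists>(\<beta> :: nat \<Rightarrow> real) (\<alpha> :: real).
        \<forall>p\<in>mixed_integer_points dx dw P. (\<forall>i<dx. Poly_Mapping.lookup p (VX i) = x' i) \<longrightarrow>
          Poly_Mapping.lookup (g p) (VY k) =
            (\<Sum>j<dw. \<beta> j * Poly_Mapping.lookup p (VW j)) + \<alpha>))"

definition has_mixed_linear_section ::
    "nat \<Rightarrow> nat \<Rightarrow> nat \<Rightarrow> var lin_system \<Rightarrow> (var \<Rightarrow>\<^sub>0 real) set \<Rightarrow> bool" where
  "has_mixed_linear_section dx dw dy Q P \<longleftrightarrow>
    (\<exists>g. is_section dx dw dy Q P g \<and> mixed_linear dx dw dy P g)"

text \<open>The map \<open>f\<close> sending \<open>(x, w)\<close> to the vector of its mixed products.\<close>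

definition mixed_product :: "nat \<Rightarrow> nat \<Rightarrow> (var \<Rightarrow>\<^sub>0 real) \<Rightarrow> (zvar \<Rightarrow>\<^sub>0 real)" where
  "mixed_product dx dw p = vec_of (z_vars dx dw) (\<lambda>e. case e of
      ZE E \<Rightarrow> (\<Prod>i\<in>E. Poly_Mapping.lookup p (VX i))
    | ZEW E j \<Rightarrow> (\<Prod>i\<in>E. Poly_Mapping.lookup p (VX i)) * Poly_Mapping.lookup p (VW j))"

text \<open>
  The identification of the original variables with the \<open>z\<close>-variables \<open>z\<^bsub>{x\<^sub>i}\<^esub>\<close> and
  \<open>z\<^bsub>{w\<^sub>j}\<^esub>\<close>; its value at \<open>VY k\<close> is never used.
\<close>

fun z_of :: "var \<Rightarrow> zvar" where
  "z_of (VX i) = ZE {i}"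
| "z_of (VW j) = ZEW {} j"
| "z_of (VY k) = undefined"

definition proj_z :: "nat \<Rightarrow> nat \<Rightarrow> (zvar \<Rightarrow>\<^sub>0 real) \<Rightarrow> (var \<Rightarrow>\<^sub>0 real)" where
  "proj_z dx dw z = vec_of (xw_vars dx dw) (\<lambda>v. Poly_Mapping.lookup z (z_of v))"

definition mixed_product_relaxation ::
    "nat \<Rightarrow> nat \<Rightarrow> zvar lin_system \<Rightarrow> (var \<Rightarrow>\<^sub>0 real) set \<Rightarrow> bool" where
  "mixed_product_relaxation dx dw D P \<longleftrightarrow>
    linear_system (z_vars dx dw) D \<and>
    P \<subseteq> proj_z dx dw ` solutions (z_vars dx dw) D \<and>
    (\<forall>p\<in>mixed_integer_points dx dw P. mixed_product dx dw p \<in> solutions (z_vars dx dw) D)"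

text \<open>
  An affine function \<open>z \<mapsto> c\<^sup>T z + d\<close> is represented by the pair \<open>(c, d)\<close>; a substitution
  assigns one to each \<open>y\<^sub>k\<close>.
\<close>

type_synonym substitution = "nat \<Rightarrow> (zvar \<Rightarrow>\<^sub>0 real) \<times> real"

definition is_substitution :: "nat \<Rightarrow> nat \<Rightarrow> nat \<Rightarrow> substitution \<Rightarrow> bool" where
  "is_substitution dx dw dy T \<longleftrightarrow> (\<forall>k<dy. fst (T k) \<in> coord_space (z_vars dx dw))"

fun subst_var :: "substitution \<Rightarrow> var \<Rightarrow> (zvar \<Rightarrow>\<^sub>0 real) \<times> real" where
  "subst_var T (VX i) = (Poly_Mapping.single (z_of (VX i)) 1, 0)"
| "subst_var T (VW j) = (Poly_Mapping.single (z_of (VW j)) 1, 0)"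
| "subst_var T (VY k) = T k"

text \<open>
  Substituting \<open>c\<^sub>v\<^sup>T z + d\<^sub>v\<close> for each variable \<open>v\<close> turns \<open>\<Sum>\<^sub>v a\<^sub>v v \<le> b\<close> into
  \<open>(\<Sum>\<^sub>v a\<^sub>v c\<^sub>v)\<^sup>T z \<le> b - \<Sum>\<^sub>v a\<^sub>v d\<^sub>v\<close>.
\<close>

definition subst_ineq ::
    "substitution \<Rightarrow> (var \<Rightarrow>\<^sub>0 real) \<times> real \<Rightarrow> (zvar \<Rightarrow>\<^sub>0 real) \<times> real" where
  "subst_ineq T = (\<lambda>(a, b).
    (\<Sum>v\<in>Poly_Mapping.keys a. Poly_Mapping.lookup a v *\<^sub>R fst (subst_var T v),
     b - (\<Sum>v\<in>Poly_Mapping.keys a. Poly_Mapping.lookup a v * snd (subst_var T v))))"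

definition subst_system :: "substitution \<Rightarrow> var lin_system \<Rightarrow> zvar lin_system" where
  "subst_system T Q = subst_ineq T ` Q"

definition is_translation ::
    "nat \<Rightarrow> nat \<Rightarrow> nat \<Rightarrow> var lin_system \<Rightarrow> (var \<Rightarrow>\<^sub>0 real) set \<Rightarrow> substitution \<Rightarrow> bool" where
  "is_translation dx dw dy Q P T \<longleftrightarrow>
    is_substitution dx dw dy T \<and> mixed_product_relaxation dx dw (subst_system T Q) P"

end

theory Submission
  imports Defs
begin

text \<open>
  A function on \<open>{0,1}\<^sup>d\<^sup>x\<close> is a multilinear polynomial, its coefficients being given by
  Moebius inversion over the subsets of \<open>{..<dx}\<close>. Applied to the coefficients of the affine
  functions \<open>g\<^sub>k\<^sup>x\<close> of the mixed linear section \<open>g\<close>, this expresses each \<open>y\<^sub>k\<close>, along the section, as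
  an affine function of the mixed products. Substituting these expressions amounts to pulling the
  feasible region of \<open>Q\<close> back along an affine map that commutes with the projections and sends the
  mixed product vector of \<open>p\<close> to \<open>g p\<close>.
\<close>

section \<open>Coordinates, linear functionals and convexity of solution sets\<close>

lemma lookup_scaleR [simp]:
  fixes v :: "'i \<Rightarrow>\<^sub>0 'b::real_vector"
  shows "Poly_Mapping.lookup (r *\<^sub>R v) i = r *\<^sub>R Poly_Mapping.lookup v i"
proof -
  have "finite {i. r *\<^sub>R Poly_Mapping.lookup v i \<noteq> 0}"
    by (rule finite_subset[OF _ finite_keys[of v]]) (auto simp: in_keys_iff)
  then show ?thesis
    by (simp add: scaleR_poly_mapping_def)
qed

lemma lookup_vec_of:
  assumes "finite I"
  shows "Poly_Mapping.lookup (vec_of I c) i = (if i \<in> I then c i else 0)"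
  using assms by (simp add: vec_of_def lookup_sum lookup_single when_def)

lemma vec_of_in_coord_space: "finite I \<Longrightarrow> vec_of I c \<in> coord_space I"
  by (auto simp: coord_space_def in_keys_iff lookup_vec_of split: if_splits)

lemma lookup_eq_0_outside: "v \<in> coord_space I \<Longrightarrow> i \<notin> I \<Longrightarrow> Poly_Mapping.lookup v i = 0"
  by (auto simp: coord_space_def in_keys_iff)

lemma subspace_coord_space: "subspace (coord_space I :: ('i \<Rightarrow>\<^sub>0 real) set)"
proof -
  have "coord_space I = {v :: 'i \<Rightarrow>\<^sub>0 real. \<forall>i. i \<notin> I \<longrightarrow> Poly_Mapping.lookup v i = 0}"
    by (auto simp: coord_space_def in_keys_iff)
  then show ?thesis
    by (simp add: subspace_def lookup_add)
qed

text \<open>\<open>dot\<close> sums over the support of its first argument, which varies with that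
  argument. Over a fixed \<open>I\<close> the sums for different functionals can be added and
  compared.\<close>

lemma dot_altdef:
  assumes "finite I" "a \<in> coord_space I"
  shows "dot a v = (\<Sum>i\<in>I. Poly_Mapping.lookup a i * Poly_Mapping.lookup v i)"
  unfolding dot_def using assms
  by (intro sum.mono_neutral_left) (auto simp: coord_space_def in_keys_iff)

lemma linear_dot_right: "linear (dot a)"
  by (intro linearI) (simp_all add: dot_def lookup_add algebra_simps sum.distrib sum_distrib_left)

lemma linear_dot_left: "linear (\<lambda>a. dot a v)"
proof (rule linearI)
  fix a b :: "'a \<Rightarrow>\<^sub>0 real" and r :: real
  \<comment> \<open>Cancellation can make the support of \<open>a + b\<close> smaller than this
    union, so all sums are taken over the union.\<close>
  define I where "I = Poly_Mapping.keys a \<union> Poly_Mapping.keys b"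
  have I: "finite I" and mem: "a \<in> coord_space I" "b \<in> coord_space I"
    by (auto simp: I_def coord_space_def)
  note sub = subspace_coord_space[of I]
  show "dot (a + b) v = dot a v + dot b v"
    using mem subspace_add[OF sub mem]
    by (simp add: dot_altdef[OF I] lookup_add algebra_simps sum.distrib)
  show "dot (r *\<^sub>R a) v = r *\<^sub>R dot a v"
    using mem subspace_scale[OF sub mem(1)]
    by (simp add: dot_altdef[OF I] algebra_simps sum_distrib_left)
qed

lemma dot_single: "dot (Poly_Mapping.single i c) v = c * Poly_Mapping.lookup v i"
  by (subst dot_altdef[of "{i}"]) (auto simp: coord_space_def)

lemma convex_solutions: "convex (solutions I S)"
proof -
  have "solutions I S = coord_space I \<inter> (\<Inter>(a, b)\<in>S. dot a -` {..b})"
    by (auto simp: solutions_def)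
  moreover have "convex (dot a -` {..b})" for a b
    by (intro convex_linear_vimage linear_dot_right) simp
  ultimately show ?thesis
    by (auto intro!: convex_Int convex_INT subspace_imp_convex[OF subspace_coord_space])
qed

section \<open>Index sets and the projection from mixed products\<close>

lemma finite_xw_vars: "finite (xw_vars dx dw)"
  by (simp add: xw_vars_def)

lemma finite_xwy_vars: "finite (xwy_vars dx dw dy)"
  by (simp add: xwy_vars_def finite_xw_vars)

lemma z_vars_altdef:
  "z_vars dx dw = ZE ` (Pow {..<dx} - {{}}) \<union> (\<lambda>(E, j). ZEW E j) ` (Pow {..<dx} \<times> {..<dw})"
  by (auto simp: z_vars_def)

lemma mem_z_vars:
  "ZE E \<in> z_vars dx dw \<longleftrightarrow> E \<noteq> {} \<and> E \<subseteq> {..<dx}"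
  "ZEW E j \<in> z_vars dx dw \<longleftrightarrow> E \<subseteq> {..<dx} \<and> j < dw"
  by (auto simp: z_vars_def)

lemma finite_z_vars: "finite (z_vars dx dw)"
  by (simp add: z_vars_altdef)

lemma sum_z_vars:
  fixes f :: "zvar \<Rightarrow> real"
  shows "sum f (z_vars dx dw) =
    (\<Sum>E\<in>Pow {..<dx} - {{}}. f (ZE E)) + (\<Sum>E\<in>Pow {..<dx}. \<Sum>j<dw. f (ZEW E j))"
proof -
  have "sum f (z_vars dx dw) = sum f (ZE ` (Pow {..<dx} - {{}})) +
      sum f ((\<lambda>(E, j). ZEW E j) ` (Pow {..<dx} \<times> {..<dw}))"
    unfolding z_vars_altdef by (intro sum.union_disjoint) auto
  also have "sum f (ZE ` (Pow {..<dx} - {{}})) = (\<Sum>E\<in>Pow {..<dx} - {{}}. f (ZE E))"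
    by (subst sum.reindex) (auto simp: inj_on_def)
  also have "sum f ((\<lambda>(E, j). ZEW E j) ` (Pow {..<dx} \<times> {..<dw})) =
      (\<Sum>E\<in>Pow {..<dx}. \<Sum>j<dw. f (ZEW E j))"
    by (subst sum.reindex) (auto simp: inj_on_def sum.cartesian_product split_def)
  finally show ?thesis .
qed

lemma z_of_in_z_vars: "v \<in> xw_vars dx dw \<Longrightarrow> z_of v \<in> z_vars dx dw"
  by (auto simp: xw_vars_def z_vars_def)

lemma linear_proj_z: "linear (proj_z dx dw)"
  by (intro linearI poly_mapping_eqI)
    (simp_all add: proj_z_def lookup_vec_of finite_xw_vars lookup_add)

text \<open>The product over \<open>{i}\<close> is \<open>x_i\<close>, and the empty product times
  \<open>w_j\<close> is \<open>w_j\<close>.\<close>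

lemma proj_z_mixed_product:
  assumes "p \<in> coord_space (xw_vars dx dw)"
  shows "proj_z dx dw (mixed_product dx dw p) = p"
proof (rule poly_mapping_eqI)
  fix v
  show "Poly_Mapping.lookup (proj_z dx dw (mixed_product dx dw p)) v = Poly_Mapping.lookup p v"
  proof (cases "v \<in> xw_vars dx dw")
    case True
    then have "Poly_Mapping.lookup (mixed_product dx dw p) (z_of v) = Poly_Mapping.lookup p v"
      using z_of_in_z_vars[OF True]
      by (auto simp: mixed_product_def lookup_vec_of finite_z_vars xw_vars_def)
    with True show ?thesis
      by (simp add: proj_z_def lookup_vec_of finite_xw_vars)
  next
    case False
    with lookup_eq_0_outside[OF assms] show ?thesis
      by (simp add: proj_z_def lookup_vec_of finite_xw_vars)
  qed
qed

section \<open>Substitution as pullback along an affine map\<close>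

definition subst_point ::
    "nat \<Rightarrow> nat \<Rightarrow> nat \<Rightarrow> substitution \<Rightarrow> (zvar \<Rightarrow>\<^sub>0 real) \<Rightarrow> (var \<Rightarrow>\<^sub>0 real)" where
  "subst_point dx dw dy T z =
    vec_of (xwy_vars dx dw dy) (\<lambda>v. dot (fst (subst_var T v)) z + snd (subst_var T v))"

text \<open>Exchanging the sums gives the same affine function of \<open>z\<close> on both sides,
  with its constant moved to the right in \<open>subst_ineq\<close>. The support condition on
  \<open>a\<close> matters because \<open>subst_point\<close> is zero outside
  \<open>xwy_vars\<close>.\<close>

lemma dot_subst_ineq:
  assumes "a \<in> coord_space (xwy_vars dx dw dy)"
  shows "dot (fst (subst_ineq T (a, b))) z \<le> snd (subst_ineq T (a, b)) \<longleftrightarrow>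
    dot a (subst_point dx dw dy T z) \<le> b"
proof -
  have "dot (fst (subst_ineq T (a, b))) z =
      (\<Sum>v\<in>Poly_Mapping.keys a. Poly_Mapping.lookup a v * dot (fst (subst_var T v)) z)"
    by (simp add: subst_ineq_def linear_sum[OF linear_dot_left] linear_cmul[OF linear_dot_left])
  moreover have "dot a (subst_point dx dw dy T z) = (\<Sum>v\<in>Poly_Mapping.keys a.
      Poly_Mapping.lookup a v * (dot (fst (subst_var T v)) z + snd (subst_var T v)))"
    unfolding dot_def[of a] using assms
    by (intro sum.cong) (auto simp: subst_point_def lookup_vec_of finite_xwy_vars coord_space_def)
  ultimately show ?thesis
    by (simp add: subst_ineq_def algebra_simps sum.distrib le_diff_eq)
qed

lemma solutions_subst_system:
  assumes "linear_system (xwy_vars dx dw dy) Q"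
  shows "z \<in> solutions (z_vars dx dw) (subst_system T Q) \<longleftrightarrow>
    z \<in> coord_space (z_vars dx dw) \<and>
    subst_point dx dw dy T z \<in> solutions (xwy_vars dx dw dy) Q"
proof -
  have "(\<forall>(c, d)\<in>subst_system T Q. dot c z \<le> d) \<longleftrightarrow>
      (\<forall>q\<in>Q. dot (fst (subst_ineq T q)) z \<le> snd (subst_ineq T q))"
    by (simp add: subst_system_def split_def)
  also have "\<dots> \<longleftrightarrow> (\<forall>(a, b)\<in>Q. dot a (subst_point dx dw dy T z) \<le> b)"
    using assms dot_subst_ineq unfolding linear_system_def by fast
  finally show ?thesis
    by (simp add: solutions_def subst_point_def vec_of_in_coord_space finite_xwy_vars)
qed

lemma linear_system_subst_system:
  assumes Q: "linear_system (xwy_vars dx dw dy) Q" and T: "is_substitution dx dw dy T"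
  shows "linear_system (z_vars dx dw) (subst_system T Q)"
proof -
  have var: "fst (subst_var T v) \<in> coord_space (z_vars dx dw)" if "v \<in> xwy_vars dx dw dy" for v
  proof (cases v)
    case (VY k)
    with that T show ?thesis
      by (auto simp: xwy_vars_def xw_vars_def is_substitution_def)
  qed (use that in \<open>auto simp: xwy_vars_def xw_vars_def coord_space_def z_vars_def\<close>)
  have "fst (subst_ineq T (a, b)) \<in> coord_space (z_vars dx dw)" if "(a, b) \<in> Q" for a b
  proof -
    have "Poly_Mapping.keys a \<subseteq> xwy_vars dx dw dy"
      using that Q by (auto simp: linear_system_def coord_space_def)
    then show ?thesis
      using var by (auto simp: subst_ineq_def intro!: subspace_sum subspace_scale subspace_coord_space)
  qed
  then show ?thesis
    using Q by (force simp: linear_system_def subst_system_def)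
qed

text \<open>Whatever \<open>T\<close> is, each \<open>x_i\<close> and \<open>w_j\<close> is replaced
  by its own \<open>z\<close>-variable with constant 0.\<close>

lemma proj_xw_subst_point: "proj_xw dx dw (subst_point dx dw dy T z) = proj_z dx dw z"
proof (rule poly_mapping_eqI)
  show "Poly_Mapping.lookup (proj_xw dx dw (subst_point dx dw dy T z)) v =
      Poly_Mapping.lookup (proj_z dx dw z) v" for v
    by (auto simp: proj_xw_def proj_z_def subst_point_def lookup_vec_of finite_xw_vars
        finite_xwy_vars xwy_vars_def dot_single) (auto simp: xw_vars_def dot_single)
qed

section \<open>Moebius inversion and interpolation on the cube\<close>

text \<open>The usual sign (-1)^(|E| - |T|) is split into two factors, the form in which symmetric
  inclusion-exclusion inverts it.\<close>

definition moebius_coeff :: "('a set \<Rightarrow> real) \<Rightarrow> 'a set \<Rightarrow> real" where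
  "moebius_coeff h E = (-1) ^ card E * (\<Sum>T\<in>Pow E. (-1) ^ card T * h T)"

lemma sum_moebius_coeff:
  assumes "finite A"
  shows "sum (moebius_coeff h) (Pow A) = h A"
  unfolding moebius_coeff_def by (rule inclusion_exclusion_symmetric[symmetric]) (use assms in auto)

text \<open>At a 0-1 point the monomial of \<open>E\<close> is the indicator of \<open>E\<close>
  being contained in the set of ones. The sum therefore reduces to the subsets of that set, where
  Moebius inversion applies.\<close>

lemma multilinear_interpolation:
  fixes x :: "'a \<Rightarrow> real"
  assumes I: "finite I" and x: "\<And>i. i \<in> I \<Longrightarrow> x i \<in> {0, 1}"
  shows "(\<Sum>E\<in>Pow I. moebius_coeff h E * (\<Prod>i\<in>E. x i)) = h {i\<in>I. x i = 1}"
proof -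
  let ?A = "{i\<in>I. x i = 1}"
  have "(\<Prod>i\<in>E. x i) = (if E \<subseteq> ?A then 1 else 0)" if E: "E \<subseteq> I" for E
  proof (cases "E \<subseteq> ?A")
    case True
    then show ?thesis by (auto intro!: prod.neutral)
  next
    case False
    then obtain i where "i \<in> E" "x i = 0"
      using E x by blast
    then show ?thesis
      using False finite_subset[OF E I] by (auto simp: prod_zero_iff)
  qed
  then have "(\<Sum>E\<in>Pow I. moebius_coeff h E * (\<Prod>i\<in>E. x i)) =
      (\<Sum>E\<in>Pow I. if E \<subseteq> ?A then moebius_coeff h E else 0)"
    by (intro sum.cong) auto
  also have "\<dots> = sum (moebius_coeff h) (Pow ?A)"
    using I by (intro sum.mono_neutral_cong_right) auto
  finally show ?thesis
    using I by (simp add: sum_moebius_coeff)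
qed

section \<open>The substitution obtained from a mixed linear section\<close>

text \<open>A 0-1 vector is encoded by its set \<open>A\<close> of ones; \<open>\<beta> A k\<close>
  and \<open>\<alpha> A k\<close> are the slopes and the constant of the \<open>k\<close>-th affine
  function there. The empty monomial of the constants has no \<open>z\<close>-variable, so its
  coefficient becomes the constant of the substitution; for the slopes it belongs to
  \<open>ZEW {} j\<close>.\<close>

definition interpolating_substitution ::
    "nat \<Rightarrow> nat \<Rightarrow> (nat set \<Rightarrow> nat \<Rightarrow> nat \<Rightarrow> real) \<Rightarrow> (nat set \<Rightarrow> nat \<Rightarrow> real) \<Rightarrow> substitution" where
  "interpolating_substitution dx dw \<beta> \<alpha> k =
    (vec_of (z_vars dx dw) (\<lambda>e. case e of
        ZE E \<Rightarrow> moebius_coeff (\<lambda>A. \<alpha> A k) E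
      | ZEW E j \<Rightarrow> moebius_coeff (\<lambda>A. \<beta> A k j) E),
     moebius_coeff (\<lambda>A. \<alpha> A k) {})"

lemma is_substitution_interpolating:
  "is_substitution dx dw dy (interpolating_substitution dx dw \<beta> \<alpha>)"
  by (simp add: is_substitution_def interpolating_substitution_def vec_of_in_coord_space
      finite_z_vars)

lemma interpolating_substitution_mixed_product:
  assumes p: "p \<in> mixed_cube dx dw"
    and A: "A = {i\<in>{..<dx}. Poly_Mapping.lookup p (VX i) = 1}"
  shows "dot (fst (interpolating_substitution dx dw \<beta> \<alpha> k)) (mixed_product dx dw p) +
      snd (interpolating_substitution dx dw \<beta> \<alpha> k) =
    (\<Sum>j<dw. \<beta> A k j * Poly_Mapping.lookup p (VW j)) + \<alpha> A k"
proof -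
  let ?x = "\<lambda>i. Poly_Mapping.lookup p (VX i)" and ?w = "\<lambda>j. Poly_Mapping.lookup p (VW j)"
  let ?a = "moebius_coeff (\<lambda>A. \<alpha> A k)" and ?b = "\<lambda>j. moebius_coeff (\<lambda>A. \<beta> A k j)"
  have interp: "(\<Sum>E\<in>Pow {..<dx}. moebius_coeff h E * (\<Prod>i\<in>E. ?x i)) = h A" for h
    unfolding A using p by (intro multilinear_interpolation) (auto simp: mixed_cube_def)
  have "dot (fst (interpolating_substitution dx dw \<beta> \<alpha> k)) (mixed_product dx dw p) =
      (\<Sum>E\<in>Pow {..<dx} - {{}}. ?a E * (\<Prod>i\<in>E. ?x i)) +
      (\<Sum>E\<in>Pow {..<dx}. \<Sum>j<dw. ?b j E * ((\<Prod>i\<in>E. ?x i) * ?w j))"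
    unfolding interpolating_substitution_def fst_conv mixed_product_def
    by (subst dot_altdef[OF finite_z_vars vec_of_in_coord_space[OF finite_z_vars]], subst sum_z_vars)
      (intro arg_cong2[of _ _ _ _ "(+)"] sum.cong;
        auto simp: lookup_vec_of finite_z_vars mem_z_vars)
  \<comment> \<open>For fixed \<open>j\<close> the factor \<open>w_j\<close> comes out, leaving the
    interpolation of the \<open>j\<close>-th slope.\<close>
  also have "(\<Sum>E\<in>Pow {..<dx}. \<Sum>j<dw. ?b j E * ((\<Prod>i\<in>E. ?x i) * ?w j)) =
      (\<Sum>j<dw. (\<Sum>E\<in>Pow {..<dx}. ?b j E * (\<Prod>i\<in>E. ?x i)) * ?w j)"
    by (subst sum.swap) (simp add: sum_distrib_right mult.assoc)
  also have "\<dots> = (\<Sum>j<dw. \<beta> A k j * ?w j)"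
    by (simp add: interp)
  finally have "dot (fst (interpolating_substitution dx dw \<beta> \<alpha> k)) (mixed_product dx dw p) =
      (\<Sum>E\<in>Pow {..<dx} - {{}}. ?a E * (\<Prod>i\<in>E. ?x i)) + (\<Sum>j<dw. \<beta> A k j * ?w j)" .
  \<comment> \<open>The constant of the substitution is exactly the summand at \<open>{}\<close>,
    which completes the interpolation of \<open>\<alpha>\<close>.\<close>
  moreover have "(\<Sum>E\<in>Pow {..<dx}. ?a E * (\<Prod>i\<in>E. ?x i)) =
      ?a {} + (\<Sum>E\<in>Pow {..<dx} - {{}}. ?a E * (\<Prod>i\<in>E. ?x i))"
    by (subst sum.remove[of _ "{}"]) auto
  ultimately show ?thesis
    by (simp add: interp interpolating_substitution_def)
qed

lemma mixed_linear_substitution: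
  assumes "mixed_linear dx dw dy P g"
  obtains T where "is_substitution dx dw dy T"
    and "\<And>p k. p \<in> mixed_integer_points dx dw P \<Longrightarrow> k < dy \<Longrightarrow>
      dot (fst (T k)) (mixed_product dx dw p) + snd (T k) = Poly_Mapping.lookup (g p) (VY k)"
proof -
  let ?x = "\<lambda>p i. Poly_Mapping.lookup p (VX i)"
  define affine where "affine A k b a \<longleftrightarrow>
      (\<forall>p\<in>mixed_integer_points dx dw P. (\<forall>i<dx. ?x p i = of_bool (i \<in> A)) \<longrightarrow>
        Poly_Mapping.lookup (g p) (VY k) = (\<Sum>j<dw. b j * Poly_Mapping.lookup p (VW j)) + a)"
    for A :: "nat set" and k and b :: "nat \<Rightarrow> real" and a :: real
  \<comment> \<open>Mixed linearity is used at the indicator vector of \<open>A\<close>. Keeping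
    \<open>k < dy\<close> under the quantifiers makes the existence total in \<open>A\<close> and
    \<open>k\<close>, so that coefficient functions can be chosen.\<close>
  have "\<exists>b a. k < dy \<longrightarrow> affine A k b a" for A k
    using assms[unfolded mixed_linear_def, rule_format, of "\<lambda>i. of_bool (i \<in> A)" k]
    unfolding affine_def by (cases "k < dy") auto
  then have "\<forall>A k. \<exists>b a. k < dy \<longrightarrow> affine A k b a"
    by (intro allI)
  then have "\<exists>\<beta> \<alpha>. \<forall>A k. k < dy \<longrightarrow> affine A k (\<beta> A k) (\<alpha> A k)"
    by (simp only: choice_iff)
  then obtain \<beta> \<alpha> where g: "\<And>A k. k < dy \<Longrightarrow> affine A k (\<beta> A k) (\<alpha> A k)"
    by blast
  show thesis
  proof
    show "is_substitution dx dw dy (interpolating_substitution dx dw \<beta> \<alpha>)"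
      by (rule is_substitution_interpolating)
  next
    fix p k
    assume p: "p \<in> mixed_integer_points dx dw P" and k: "k < dy"
    let ?A = "{i\<in>{..<dx}. ?x p i = 1}"
    have cube: "p \<in> mixed_cube dx dw"
      using p by (simp add: mixed_integer_points_def)
    then have "\<forall>i<dx. ?x p i = of_bool (i \<in> ?A)"
      by (auto simp: mixed_cube_def)
    then have "Poly_Mapping.lookup (g p) (VY k) =
        (\<Sum>j<dw. \<beta> ?A k j * Poly_Mapping.lookup p (VW j)) + \<alpha> ?A k"
      using g[OF k, of ?A, unfolded affine_def] p by blast
    then show "dot (fst (interpolating_substitution dx dw \<beta> \<alpha> k)) (mixed_product dx dw p) +
        snd (interpolating_substitution dx dw \<beta> \<alpha> k) = Poly_Mapping.lookup (g p) (VY k)"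
      by (simp add: interpolating_substitution_mixed_product[OF cube refl])
  qed
qed

text \<open>A point of \<open>coord_space (xwy_vars dx dw dy)\<close> is determined by its
  projection and its \<open>y\<close>-coordinates, and both agree here. With \<open>q\<close> taken
  as \<open>g p\<close>, the affine map carries mixed products to the section.\<close>

lemma subst_point_mixed_product:
  assumes p: "p \<in> coord_space (xw_vars dx dw)"
    and q: "q \<in> coord_space (xwy_vars dx dw dy)" "proj_xw dx dw q = p"
    and T: "\<And>k. k < dy \<Longrightarrow>
      dot (fst (T k)) (mixed_product dx dw p) + snd (T k) = Poly_Mapping.lookup q (VY k)"
  shows "subst_point dx dw dy T (mixed_product dx dw p) = q"
proof (rule poly_mapping_eqI)
  fix v
  let ?q = "subst_point dx dw dy T (mixed_product dx dw p)"
  have proj: "proj_xw dx dw ?q = proj_xw dx dw q"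
    by (simp add: proj_xw_subst_point proj_z_mixed_product p q(2))
  consider "v \<in> xw_vars dx dw" | k where "v = VY k" "k < dy" | "v \<notin> xwy_vars dx dw dy"
    by (auto simp: xwy_vars_def)
  then show "Poly_Mapping.lookup ?q v = Poly_Mapping.lookup q v"
  proof cases
    case 1
    then show ?thesis
      using arg_cong[OF proj, of "\<lambda>r. Poly_Mapping.lookup r v"]
      by (simp add: proj_xw_def lookup_vec_of finite_xw_vars)
  next
    case 2
    then show ?thesis
      by (simp add: subst_point_def lookup_vec_of finite_xwy_vars xwy_vars_def finite_xw_vars T)
  next
    case 3
    then show ?thesis
      by (simp add: subst_point_def lookup_vec_of finite_xwy_vars lookup_eq_0_outside[OF q(1)])
  qed
qed

theorem theorem3p2:
  fixes dx dw dy :: nat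
    and P :: "(var \<Rightarrow>\<^sub>0 real) set"
    and Q :: "var lin_system"
    and s :: sense
    and Obj :: "(var \<Rightarrow>\<^sub>0 real) set"
    and \<rho> :: real
  assumes "mixed_integer_polytope dx dw P"
    and "\<rho> \<ge> 1"
    and "Obj \<subseteq> coord_space (xw_vars dx dw)"
    and "approx_extended_formulation s Obj \<rho> dx dw dy Q P"
    and "has_mixed_linear_section dx dw dy Q P"
  shows "\<exists>T. is_translation dx dw dy Q P T \<and>
    P \<subseteq> proj_z dx dw ` solutions (z_vars dx dw) (subst_system T Q) \<and>
    proj_z dx dw ` solutions (z_vars dx dw) (subst_system T Q) \<subseteq>
      proj_xw dx dw ` solutions (xwy_vars dx dw dy) Q"
proof -
  have Q: "linear_system (xwy_vars dx dw dy) Q"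
    using assms(4) by (simp add: approx_extended_formulation_def extended_relaxation_def)
  obtain M where M: "M \<subseteq> mixed_cube dx dw" "P = convex hull M"
    using assms(1) by (auto simp: mixed_integer_polytope_def)
  obtain g where g: "is_section dx dw dy Q P g" "mixed_linear dx dw dy P g"
    using assms(5) by (auto simp: has_mixed_linear_section_def)
  from g(2) obtain T where T: "is_substitution dx dw dy T"
    and Tg: "\<And>p k. p \<in> mixed_integer_points dx dw P \<Longrightarrow> k < dy \<Longrightarrow>
      dot (fst (T k)) (mixed_product dx dw p) + snd (T k) = Poly_Mapping.lookup (g p) (VY k)"
    by (rule mixed_linear_substitution) blast
  let ?D = "solutions (z_vars dx dw) (subst_system T Q)"
  have coord: "p \<in> coord_space (xw_vars dx dw)" if "p \<in> mixed_integer_points dx dw P" for p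
    using that by (simp add: mixed_integer_points_def mixed_cube_def)
  have product: "mixed_product dx dw p \<in> ?D" if p: "p \<in> mixed_integer_points dx dw P" for p
  proof -
    have gp: "g p \<in> solutions (xwy_vars dx dw dy) Q" "proj_xw dx dw (g p) = p"
      using g(1) p by (auto simp: is_section_def)
    then have "subst_point dx dw dy T (mixed_product dx dw p) = g p"
      by (intro subst_point_mixed_product coord p Tg) (auto simp: solutions_def)
    moreover have "mixed_product dx dw p \<in> coord_space (z_vars dx dw)"
      by (simp add: mixed_product_def vec_of_in_coord_space finite_z_vars)
    ultimately show ?thesis
      using gp(1) by (simp add: solutions_subst_system[OF Q])
  qed
  \<comment> \<open>The generators lie in both \<open>P\<close> and the mixed cube, so the section
    is defined on them and their mixed products are feasible preimages.\<close>
  have "M \<subseteq> proj_z dx dw ` ?D"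
  proof
    fix p assume "p \<in> M"
    then have p: "p \<in> mixed_integer_points dx dw P"
      using M hull_subset[of M convex] by (auto simp: mixed_integer_points_def)
    show "p \<in> proj_z dx dw ` ?D"
      using proj_z_mixed_product[OF coord[OF p]] product[OF p] by (metis imageI)
  qed
  \<comment> \<open>The linear image of the convex set \<open>?D\<close> is convex, so containing
    \<open>M\<close> it contains the hull of \<open>M\<close>.\<close>
  then have P: "P \<subseteq> proj_z dx dw ` ?D"
    unfolding M(2) by (intro hull_minimal convex_linear_image linear_proj_z convex_solutions)
  \<comment> \<open>For \<open>z\<close> in \<open>?D\<close>, the point
    \<open>subst_point dx dw dy T z\<close> solves \<open>Q\<close> and has the same
    projection.\<close>
  have "proj_z dx dw ` ?D \<subseteq> proj_xw dx dw ` solutions (xwy_vars dx dw dy) Q"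
    using solutions_subst_system[OF Q] by (auto simp flip: proj_xw_subst_point[of _ _ dy T])
  moreover have "is_translation dx dw dy Q P T"
    using T P product linear_system_subst_system[OF Q T]
    by (simp add: is_translation_def mixed_product_relaxation_def)
  ultimately show ?thesis
    using P by blast
qed

end
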